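(* Let $0<\alpha<1$, let $v$ be a weight on $\mathbb{R}_+=(0,\infty)$, and let $p:\mathbb{R}_+\to\mathbb{R}_+$ be a measurable function with $0<p^-\le p^+<\infty$, where $p^-=\operatorname{ess\,inf}_{x\in\mathbb{R}_+}p(x)$ and $p^+=\operatorname{ess\,sup}_{x\in\mathbb{R}_+}p(x)$. Assume that $\psi_{p(\cdot),v}(0^+)=0$. Then the following statements are equivalent: (i) There exists a positive constant $C$ such that for every $f\in D(\mathbb{R}_+)$, $$\int_0^\infty \big(R_\alpha f(x)\big)^{p(x)}v(x)\,dx\le C\int_0^\infty \big(f(x)\big)^{p(x)}v(x)\,dx .$$ (ii) There exists a positive constant $C$ such that for all $r,s>0$, $$\int_r^\infty\Big(\frac{r}{sx}\Big)^{p(x)}v(x)\,dx\le C\int_0^r\frac{v(x)}{s^{p(x)}}\,dx .$$ (iii) There is a constant $p_0$ such that $p=p_0$ a.e. on $\operatorname{supp} v$, and $v\in B_{p_0}$.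
   Context: A weight on $\mathbb{R}_+=(0,\infty)$ is a non-negative measurable function on $\mathbb{R}_+$. $D(\mathbb{R}_+)$ denotes the class of all non-negative decreasing (i.e. non-increasing) functions on $\mathbb{R}_+$. For $0<\alpha<1$ the Riemann-Liouville operator is $$R_\alpha f(x)=\frac{1}{x^\alpha}\int_0^x\frac{f(t)}{(x-t)^{1-\alpha}}\,dt,\qquad x>0.$$ For an exponent $p$ and a weight $v$ on $\mathbb{R}_+$, the local oscillation of $p$ is, for $\eta>0$, $$\psi_{p(\cdot),v}(\eta)=\operatorname*{ess\,sup}_{x\in(0,\eta)\cap\operatorname{supp}v}p(x)-\operatorname*{ess\,inf}_{x\in(0,\eta)\cap\operatorname{supp}v}p(x),$$ where $\operatorname{supp}v$ is the support of $v$, and $\psi_{p(\cdot),v}(0^+)=\lim_{\eta\to0^+}\psi_{p(\cdot),v}(\eta)$. For a constant $0<r<\infty$, $v\in B_r$ means that there is a positive constant $C$ such that for all $s>0$, $$\int_s^\infty\Big(\frac{s}{x}\Big)^r v(x)\,dx\le C\int_0^s v(x)\,dx .$$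
   Formalization: The weight v is additionally assumed integrable on some interval (0,δ); without this the claim fails, e.g. v(x)=1/x, p=1 on (0,1), p=2 on [1,∞), where (i) and (ii) hold trivially (infinite right-hand sides) but (iii) fails. *)

theory Defs
  imports "HOL-Probability.Essential_Supremum"
begin

text \<open>
  Functions on the half-line \<open>(0,\<infinity>)\<close> are total functions on \<open>real\<close> of which only the values on
  \<open>{0<..}\<close> matter. Integrals of non-negative functions take values in \<open>ennreal\<close>, so that they may be
  infinite; measurability is Lebesgue measurability.
\<close>

definition weight :: "(real \<Rightarrow> real) \<Rightarrow> bool" where
  "weight v \<longleftrightarrow> v \<in> borel_measurable (lebesgue_on {0<..}) \<and> (\<forall>x>0. 0 \<le> v x)"

definition decr_fun :: "(real \<Rightarrow> real) set" where
  "decr_fun = {f. (\<forall>x>0. 0 \<le> f x) \<and> antimono_on {0<..} f}"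

text \<open>
  The support is the set where the weight does not vanish, not its topological closure: the closure
  may contain a set of positive measure on which \<open>v = 0\<close>.
\<close>

definition weight_supp :: "(real \<Rightarrow> real) \<Rightarrow> real set" where
  "weight_supp v = {x. 0 < x \<and> v x \<noteq> 0}"

text \<open>For \<open>q > 0\<close>, the only case used, this is the continuous extension of \<open>a powr q\<close> to \<open>a = \<infinity>\<close>.\<close>

definition ennreal_power :: "ennreal \<Rightarrow> real \<Rightarrow> ennreal" where
  "ennreal_power a q = (if a = \<infinity> then \<infinity> else ennreal (enn2real a powr q))"

definition riemann_liouville :: "real \<Rightarrow> (real \<Rightarrow> real) \<Rightarrow> real \<Rightarrow> ennreal" where
  "riemann_liouville \<alpha> f x =
     ennreal (1 / x powr \<alpha>) *
     (\<integral>\<^sup>+t\<in>{0<..<x}. ennreal (f t / (x - t) powr (1 - \<alpha>)) \<partial>lebesgue)"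

definition essinf :: "'a measure \<Rightarrow> ('a \<Rightarrow> ennreal) \<Rightarrow> ennreal" where
  "essinf M f = Sup {z. AE x in M. z \<le> f x}"

text \<open>
  The difference is taken in \<open>ennreal\<close>. It is the ordinary one unless \<open>v = 0\<close> a.e. on \<open>(0,\<eta>)\<close>; then the
  essential supremum is \<open>0\<close>, the essential infimum is \<open>\<infinity>\<close>, and the truncated difference makes the
  oscillation over this null set \<open>0\<close>.
\<close>

definition local_osc :: "(real \<Rightarrow> real) \<Rightarrow> (real \<Rightarrow> real) \<Rightarrow> real \<Rightarrow> ennreal" where
  "local_osc p v \<eta> =
     esssup (lebesgue_on ({0<..<\<eta>} \<inter> weight_supp v)) (\<lambda>x. ennreal (p x)) -
     essinf (lebesgue_on ({0<..<\<eta>} \<inter> weight_supp v)) (\<lambda>x. ennreal (p x))"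

definition B_class :: "real \<Rightarrow> (real \<Rightarrow> real) set" where
  "B_class r = {v. \<exists>C>0::real. \<forall>s>0.
     (\<integral>\<^sup>+x\<in>{s<..}. ennreal ((s / x) powr r * v x) \<partial>lebesgue)
       \<le> ennreal C * (\<integral>\<^sup>+x\<in>{0<..<s}. ennreal (v x) \<partial>lebesgue)}"

end

theory Submission
  imports Defs
begin

text \<open>
  Testing (i) on multiples of indicators of \<open>(0,r)\<close> gives (ii). In (ii) the parameter \<open>s\<close> scales the
  integrands by \<open>s powr - p x\<close>: letting \<open>s\<close> tend to \<open>0\<close> and to \<open>\<infinity>\<close>, every essential bound for \<open>p\<close> on
  \<open>(0,r)\<close> extends to the whole support of \<open>v\<close>, and the vanishing oscillation at \<open>0\<close> forces \<open>p\<close> to be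
  constant; then \<open>s = 1\<close> is the \<open>B\<close> condition.

  For (iii) \<open>\<Longrightarrow>\<close> (i), cutting \<open>(0,x)\<close> dyadically bounds \<open>R\<^sub>\<alpha> f x\<close> by a multiple of
  \<open>\<Sum>k. f (x / 2 ^ Suc k) / 2 ^ Suc k\<close>. The \<open>B\<close> condition with exponent \<open>q\<close> improves itself to
  \<open>V (2 ^ k * s) \<le> const * \<mu> ^ k * V s\<close> with \<open>\<mu> < 2 powr q\<close>, where \<open>V s\<close> is the integral of \<open>v\<close> over
  \<open>(0,s)\<close>. Since level sets of decreasing functions are intervals \<open>(0,s)\<close>, the \<open>k\<close>-th dilate of \<open>f powr q\<close>
  has integral at most \<open>const * \<mu> ^ k\<close> times that of \<open>f powr q\<close>, which the factors \<open>2 ^ Suc k\<close> make summable.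
\<close>

section \<open>Layer-cake formula and dilations of decreasing functions\<close>

lemma ident_measurable_lebesgue [measurable]: "(\<lambda>x::real. x) \<in> borel_measurable lebesgue"
  by (intro measurable_completion) simp

text \<open>Needed to apply Fubini to \<open>lebesgue\<close>, which is a completion: a countable
  cover by sets of finite measure remains one after completing.\<close>

lemma sigma_finite_completion:
  assumes "sigma_finite_measure M"
  shows "sigma_finite_measure (completion M)"
proof -
  interpret sigma_finite_measure M by fact
  obtain A where A: "countable A" "A \<subseteq> sets M" "\<Union>A = space M" "\<forall>a\<in>A. emeasure M a \<noteq> \<infinity>"
    using sigma_finite_countable by blast
  show ?thesis
    using A by unfold_locales (auto intro!: exI[of _ A] simp: subset_eq)
qed

text \<open>\<open>ennreal (g x)\<close> is the length of \<open>{0..<g x}\<close>, also for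
  negative \<open>g x\<close>, where both are 0; Tonelli then exchanges the two integrals.\<close>

lemma nn_integral_layer_cake:
  fixes g :: "'a \<Rightarrow> real" and w :: "'a \<Rightarrow> ennreal"
  assumes M: "sigma_finite_measure M"
    and [measurable]: "g \<in> borel_measurable M" "w \<in> borel_measurable M"
  shows "(\<integral>\<^sup>+x. ennreal (g x) * w x \<partial>M)
    = (\<integral>\<^sup>+l\<in>{0..}. (\<integral>\<^sup>+x. w x * indicator {x. l < g x} x \<partial>M) \<partial>lborel)"
proof -
  interpret P: pair_sigma_finite M lborel
    unfolding pair_sigma_finite_def using M lborel.sigma_finite_measure_axioms by simp
  have "(\<integral>\<^sup>+x. ennreal (g x) * w x \<partial>M)
      = (\<integral>\<^sup>+x. (\<integral>\<^sup>+l. indicator {0..} l * (w x * indicator {x. l < g x} x) \<partial>lborel) \<partial>M)"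
  proof (rule nn_integral_cong)
    fix x
    have "ennreal (g x) = emeasure lborel {0..<g x}"
      by (cases "0 \<le> g x") (auto simp: ennreal_neg)
    then have "ennreal (g x) * w x = (\<integral>\<^sup>+l. w x * indicator {0..<g x} l \<partial>lborel)"
      by (subst nn_integral_cmult) (auto simp: mult.commute)
    also have "\<dots> = (\<integral>\<^sup>+l. indicator {0..} l * (w x * indicator {x. l < g x} x) \<partial>lborel)"
      by (rule nn_integral_cong) (auto split: split_indicator)
    finally show "ennreal (g x) * w x = \<dots>" .
  qed
  also have "\<dots> = (\<integral>\<^sup>+l. (\<integral>\<^sup>+x. indicator {0..} l * (w x * indicator {x. l < g x} x) \<partial>M) \<partial>lborel)"
    by (rule P.Fubini'[symmetric]) (simp add: indicator_def case_prod_beta)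
  also have "\<dots> = (\<integral>\<^sup>+l\<in>{0..}. (\<integral>\<^sup>+x. w x * indicator {x. l < g x} x \<partial>M) \<partial>lborel)"
    by (intro nn_integral_cong) (auto split: split_indicator)
  finally show ?thesis .
qed

text \<open>A nonempty down-closed subset of the half-line is, up to an endpoint of measure zero,
  either an interval \<open>{0<..<r}\<close>, where \<open>dil\<close> applies directly, or the
  whole half-line, which is reached by monotone convergence.\<close>

lemma nn_integral_dilate_down_set:
  fixes w :: "real \<Rightarrow> ennreal"
  assumes [measurable]: "w \<in> borel_measurable lebesgue" and T: "0 < T"
    and dil: "\<And>r. 0 < r \<Longrightarrow> (\<integral>\<^sup>+x\<in>{0<..<T * r}. w x \<partial>lebesgue) \<le> M * (\<integral>\<^sup>+x\<in>{0<..<r}. w x \<partial>lebesgue)"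
    and I: "I \<subseteq> {0<..}" "\<And>x y. x \<in> I \<Longrightarrow> 0 < y \<Longrightarrow> y \<le> x \<Longrightarrow> y \<in> I"
  shows "(\<integral>\<^sup>+x\<in>{x. x / T \<in> I}. w x \<partial>lebesgue) \<le> M * (\<integral>\<^sup>+x\<in>I. w x \<partial>lebesgue)"
proof (cases "bdd_above I")
  case True
  show ?thesis
  proof (cases "I = {}")
    case False
    define r where "r = Sup I"
    have le: "x \<le> r" if "x \<in> I" for x
      unfolding r_def using that True by (rule cSup_upper)
    have "0 < r" using False I(1) le by force
    have sub: "{0<..<r} \<subseteq> I"
    proof
      fix y assume y: "y \<in> {0<..<r}"
      then obtain x where "x \<in> I" "y < x"
        unfolding r_def using less_cSup_iff[OF False True] by auto
      then show "y \<in> I" using I(2) y by auto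
    qed
    have "(\<integral>\<^sup>+x\<in>{x. x / T \<in> I}. w x \<partial>lebesgue) \<le> (\<integral>\<^sup>+x\<in>{0<..<T * r}. w x \<partial>lebesgue)"
    proof (rule nn_integral_mono_AE)
      have "AE x in lebesgue. x \<noteq> T * r"
        by (rule AE_completion) (rule AE_lborel_singleton)
      then show "AE x in lebesgue. w x * indicator {x. x / T \<in> I} x \<le> w x * indicator {0<..<T * r} x"
      proof eventually_elim
        fix x assume "x \<noteq> T * r"
        moreover have "0 < x \<and> x \<le> T * r" if "x / T \<in> I"
          using le[OF that] I(1) that T by (auto simp: field_simps zero_less_divide_iff)
        ultimately show "w x * indicator {x. x / T \<in> I} x \<le> w x * indicator {0<..<T * r} x"
          by (auto split: split_indicator)
      qed
    qed
    also have "\<dots> \<le> M * (\<integral>\<^sup>+x\<in>{0<..<r}. w x \<partial>lebesgue)" by (rule dil) fact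
    also have "\<dots> \<le> M * (\<integral>\<^sup>+x\<in>I. w x \<partial>lebesgue)"
      using sub by (intro mult_left_mono nn_integral_mono) (auto split: split_indicator)
    finally show ?thesis .
  qed auto
next
  case False
  have Ieq: "I = {0<..}"
  proof (intro equalityI subsetI)
    fix y :: real assume "y \<in> {0<..}"
    moreover obtain x where "x \<in> I" "y < x" using False by (meson bdd_above.I not_le)
    ultimately show "y \<in> I" using I(2) by auto
  qed (use I in auto)
  have "(\<integral>\<^sup>+x\<in>{x. x / T \<in> I}. w x \<partial>lebesgue) = (\<integral>\<^sup>+x. (SUP n. w x * indicator {0<..<T * real (Suc n)} x) \<partial>lebesgue)"
  proof (rule nn_integral_cong)
    fix x
    obtain n where n: "x / T < real n" using reals_Archimedean2 by blast
    then have "x < T * real (Suc n)" using T by (simp add: field_simps)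
    show "w x * indicator {x. x / T \<in> I} x = (SUP n. w x * indicator {0<..<T * real (Suc n)} x)"
    proof (rule antisym)
      show "w x * indicator {x. x / T \<in> I} x \<le> (SUP n. w x * indicator {0<..<T * real (Suc n)} x)"
        using \<open>x < _\<close> T by (intro SUP_upper2[of n]) (auto split: split_indicator simp: Ieq zero_less_divide_iff)
        show "(SUP n. w x * indicator {0<..<T * real (Suc n)} x) \<le> w x * indicator {x. x / T \<in> I} x"
        using T by (intro SUP_least) (auto split: split_indicator simp: Ieq)
    qed
  qed
  also have "\<dots> = (SUP n. \<integral>\<^sup>+x\<in>{0<..<T * real (Suc n)}. w x \<partial>lebesgue)"
  proof (rule nn_integral_monotone_convergence_SUP)
    show "incseq (\<lambda>i x. w x * indicator {0<..<T * real (Suc i)} x)"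
      using T by (intro incseq_SucI le_funI)
        (auto split: split_indicator simp: field_simps intro: less_le_trans)
  qed measurable
  also have "\<dots> \<le> M * (\<integral>\<^sup>+x\<in>I. w x \<partial>lebesgue)"
  proof (rule SUP_least)
    \<comment> \<open>\<open>Suc n\<close> keeps the radius positive, as \<open>dil\<close>
      requires.\<close>
    fix n
    have "(\<integral>\<^sup>+x\<in>{0<..<T * real (Suc n)}. w x \<partial>lebesgue) \<le> M * (\<integral>\<^sup>+x\<in>{0<..<real (Suc n)}. w x \<partial>lebesgue)"
      by (rule dil) simp
    also have "\<dots> \<le> M * (\<integral>\<^sup>+x\<in>I. w x \<partial>lebesgue)"
      by (intro mult_left_mono nn_integral_mono) (auto split: split_indicator simp: Ieq)
    finally show "(\<integral>\<^sup>+x\<in>{0<..<T * real (Suc n)}. w x \<partial>lebesgue) \<le> M * (\<integral>\<^sup>+x\<in>I. w x \<partial>lebesgue)" .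
  qed
  finally show ?thesis .
qed

text \<open>\<open>decr_fun\<close> demands no measurability; monotonicity supplies it, and the
  extension by zero discards the arbitrary values off the half-line.\<close>

lemma decr_fun_measurable:
  assumes "f \<in> decr_fun"
  shows "(\<lambda>x. if 0 < x then f x else 0) \<in> borel_measurable borel"
proof -
  have "mono_on {0<..} (\<lambda>x. - f x)"
    using assms by (auto simp: decr_fun_def monotone_on_def)
  then have "(\<lambda>x. - f x) \<in> borel_measurable (restrict_space borel {0<..})"
    by (rule borel_measurable_mono_on_fnc)
  then have "f \<in> borel_measurable (restrict_space borel {0<..})"
    by (simp add: borel_measurable_uminus_eq)
  then show ?thesis
    by (subst (asm) measurable_restrict_space_iff[where c = 0]) auto
qed

text \<open>By the layer-cake formula it suffices to compare superlevel sets. For a decreasing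
  function extended by zero, those of levels \<open>l \<ge> 0\<close> are down-closed subsets of the
  half-line.\<close>

lemma nn_integral_dilate_decr_fun:
  fixes w :: "real \<Rightarrow> ennreal"
  assumes w[measurable]: "w \<in> borel_measurable lebesgue" and T: "0 < T"
    and dil: "\<And>r. 0 < r \<Longrightarrow> (\<integral>\<^sup>+x\<in>{0<..<T * r}. w x \<partial>lebesgue) \<le> M * (\<integral>\<^sup>+x\<in>{0<..<r}. w x \<partial>lebesgue)"
    and g: "g \<in> decr_fun"
  shows "(\<integral>\<^sup>+x\<in>{0<..}. ennreal (g (x / T)) * w x \<partial>lebesgue) \<le> M * (\<integral>\<^sup>+x\<in>{0<..}. ennreal (g x) * w x \<partial>lebesgue)"
proof -
  define h where "h x = (if 0 < x then g x else 0)" for x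
  have hb[measurable]: "h \<in> borel_measurable borel"
    unfolding h_def[abs_def] using g by (rule decr_fun_measurable)
  then have h[measurable]: "h \<in> borel_measurable lebesgue"
    by (intro measurable_completion) simp
  have hT[measurable]: "(\<lambda>x. h (x / T)) \<in> borel_measurable lebesgue"
    by (intro measurable_completion) simp
  have sf: "sigma_finite_measure (lebesgue :: real measure)"
    by (rule sigma_finite_completion) (rule lborel.sigma_finite_measure_axioms)
  have "(\<integral>\<^sup>+x\<in>{0<..}. ennreal (g (x / T)) * w x \<partial>lebesgue) = (\<integral>\<^sup>+x. ennreal (h (x / T)) * w x \<partial>lebesgue)"
    using T by (intro nn_integral_cong) (auto simp: h_def zero_less_divide_iff split: split_indicator)
  also have "\<dots> = (\<integral>\<^sup>+l\<in>{0..}. (\<integral>\<^sup>+x. w x * indicator {x. l < h (x / T)} x \<partial>lebesgue) \<partial>lborel)"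
    by (rule nn_integral_layer_cake[OF sf hT w])
  also have "\<dots> \<le> (\<integral>\<^sup>+l\<in>{0..}. M * (\<integral>\<^sup>+x. w x * indicator {x. l < h x} x \<partial>lebesgue) \<partial>lborel)"
  proof (rule nn_integral_mono)
    fix l :: real
    have "(\<integral>\<^sup>+x. w x * indicator {x. x / T \<in> {x. l < h x}} x \<partial>lebesgue) \<le> M * (\<integral>\<^sup>+x. w x * indicator {x. l < h x} x \<partial>lebesgue)"
      if "0 \<le> l"
    proof (rule nn_integral_dilate_down_set[OF w T dil])
      show "{x. l < h x} \<subseteq> {0<..}" using that by (auto simp: h_def split: if_splits)
      show "y \<in> {x. l < h x}" if "x \<in> {x. l < h x}" "0 < y" "y \<le> x" for x y
        using that g \<open>0 \<le> l\<close> by (force simp: h_def decr_fun_def monotone_on_def split: if_splits)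
    qed
    then show "(\<integral>\<^sup>+x. w x * indicator {x. l < h (x / T)} x \<partial>lebesgue) * indicator {0..} l
        \<le> M * (\<integral>\<^sup>+x. w x * indicator {x. l < h x} x \<partial>lebesgue) * indicator {0..} l"
      by (auto split: split_indicator)
  qed
  also have "\<dots> = M * (\<integral>\<^sup>+l\<in>{0..}. (\<integral>\<^sup>+x. w x * indicator {x. l < h x} x \<partial>lebesgue) \<partial>lborel)"
  proof -
    interpret L: sigma_finite_measure "lebesgue :: real measure" by (rule sf)
    have [measurable]: "(\<lambda>l. \<integral>\<^sup>+x. w x * indicator {x. l < h x} x \<partial>lebesgue) \<in> borel_measurable lborel"
      by (intro L.borel_measurable_nn_integral) (simp add: indicator_def case_prod_beta)
    show ?thesis by (subst nn_integral_cmult[symmetric]) (auto simp: mult.assoc)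
  qed
  also have "\<dots> = M * (\<integral>\<^sup>+x. ennreal (h x) * w x \<partial>lebesgue)"
    by (simp add: nn_integral_layer_cake[OF sf h w])
  also have "(\<integral>\<^sup>+x. ennreal (h x) * w x \<partial>lebesgue) = (\<integral>\<^sup>+x\<in>{0<..}. ennreal (g x) * w x \<partial>lebesgue)"
    by (intro nn_integral_cong) (auto simp: h_def split: split_indicator)
  finally show ?thesis .
qed

section \<open>Self-improvement of the B condition\<close>

text \<open>Used directly, the B condition bounds the integral of \<open>w\<close> over
  \<open>(0,2s)\<close> by \<open>1 + 2 powr p * C\<close> times that over \<open>(0,s)\<close>, a
  factor that need not lie below \<open>2 powr p\<close>. Replacing the indicator of
  \<open>(0,s)\<close> by \<open>min 1 (s / x) powr p\<close> yields the strict gain.\<close>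

lemma B_class_self_improving:
  fixes w :: "real \<Rightarrow> ennreal"
  assumes [measurable]: "w \<in> borel_measurable lebesgue" and p: "0 < p" and C: "0 < C"
    and B: "\<And>s. 0 < s \<Longrightarrow> (\<integral>\<^sup>+x\<in>{s<..}. ennreal ((s / x) powr p) * w x \<partial>lebesgue)
      \<le> ennreal C * (\<integral>\<^sup>+x\<in>{0<..<s}. w x \<partial>lebesgue)"
  obtains \<mu> where "0 < \<mu>" "\<mu> < 2 powr p"
    "\<And>k s. 0 < s \<Longrightarrow> (\<integral>\<^sup>+x\<in>{0<..<2 ^ k * s}. w x \<partial>lebesgue)
      \<le> ennreal ((1 + C) * \<mu> ^ k) * (\<integral>\<^sup>+x\<in>{0<..<s}. w x \<partial>lebesgue)"
proof -
  \<comment> \<open>\<open>W\<close> is comparable to \<open>V\<close>, and the difference \<open>2 powr p * W s - W (2 * s)\<close> dominates a multiple of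
    \<open>V s\<close>, hence of \<open>W s\<close>.\<close>
  define V where "V s = (\<integral>\<^sup>+x\<in>{0<..<s}. w x \<partial>lebesgue)" for s
  define u where "u s x = min 1 (s / x) powr p" for s x :: real
  have [measurable]: "u s \<in> borel_measurable lebesgue" for s
    unfolding u_def by (intro measurable_completion) simp
  define W where "W s = (\<integral>\<^sup>+x\<in>{0<..}. ennreal (u s x) * w x \<partial>lebesgue)" for s
  have u_less: "u s x = 1" if "0 < x" "x < s" for s x
    using that by (simp add: u_def min_def)
  have V_le_W: "V s \<le> W s" for s
    unfolding V_def W_def by (intro nn_integral_mono) (auto simp: u_less split: split_indicator)
  have W_le_V: "W s \<le> ennreal (1 + C) * V s" if s: "0 < s" for s
  proof -
    \<comment> \<open>The point \<open>s\<close>, missed by both indicators on the right, is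
      null.\<close>
    have "W s \<le> (\<integral>\<^sup>+x. w x * indicator {0<..<s} x + ennreal ((s / x) powr p) * w x * indicator {s<..} x \<partial>lebesgue)"
      unfolding W_def
    proof (rule nn_integral_mono_AE)
      have "AE x in lebesgue. x \<noteq> s"
        by (rule AE_completion) (rule AE_lborel_singleton)
      then show "AE x in lebesgue. ennreal (u s x) * w x * indicator {0<..} x
        \<le> w x * indicator {0<..<s} x + ennreal ((s / x) powr p) * w x * indicator {s<..} x"
        by eventually_elim (use s p in \<open>auto simp: u_def min_def split: split_indicator\<close>)
    qed
    also have "\<dots> = V s + (\<integral>\<^sup>+x\<in>{s<..}. ennreal ((s / x) powr p) * w x \<partial>lebesgue)"
    proof -
      have [measurable]: "(\<lambda>x. (s / x) powr p) \<in> borel_measurable lebesgue"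
        by (intro measurable_completion) simp
      show ?thesis unfolding V_def by (rule nn_integral_add) measurable
    qed
    also have "\<dots> \<le> V s + ennreal C * V s"
      using B[OF s] by (auto simp: V_def intro: add_left_mono)
    also have "\<dots> = ennreal (1 + C) * V s"
      using C by (simp add: ennreal_plus distrib_right)
    finally show ?thesis .
  qed
  define P where "P = 2 powr p"
  have p2: "1 < P" using p by (simp add: P_def)
  \<comment> \<open>The value with \<open>c * (1 + C) = P - 1\<close>: by \<open>W_le_V\<close>, the
    surplus \<open>(P - 1) * V s\<close> is then at least \<open>c * W s\<close>. The number \<mu>
    will be \<open>P - c\<close>, which is positive because \<open>c < P\<close>.\<close>
  define c where "c = (P - 1) / (1 + C)"
  have c: "0 < c" "c < P" 
  proof -
    show "0 < c" using C p2 by (auto simp: c_def)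
    have "0 < P * C" using C p2 by simp
    then have "P - 1 < P * (1 + C)" by (simp only: distrib_left mult_1_right)
    moreover have "0 < 1 + C" using C by simp
    ultimately show "c < P" unfolding c_def by (simp only: pos_divide_less_eq)
  qed
  \<comment> \<open>Below \<open>s\<close> both truncated powers equal 1, which leaves room for
    \<open>P - 1\<close>; from \<open>s\<close> on, doubling \<open>s\<close> costs at most the
    factor \<open>P\<close>.\<close>
  have pw: "u (2 * s) x + (P - 1) * indicator {0<..<s} x \<le> P * u s x" if "0 < s" "0 < x" for s x
  proof (cases "x < s")
    case True
    then have "u (2 * s) x = 1" "u s x = 1" using that by (auto intro!: u_less)
    with True that show ?thesis by simp
  next
    case False
    have "min 1 (2 * s / x) powr p \<le> (2 * (s / x)) powr p"
      using that p by (intro powr_mono2) auto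
    also have "\<dots> = P * (s / x) powr p" unfolding P_def by (rule powr_mult)
    also have "(s / x) powr p = u s x"
      using False that by (simp add: u_def min_def)
    finally show ?thesis using False by (simp add: u_def)
  qed
  \<comment> \<open>Moving \<open>c * W s\<close> to the other side requires finiteness; an infinite
    \<open>W s\<close> makes the claim trivial since \<open>P - c\<close> is positive.\<close>
  have step: "W (2 * s) \<le> ennreal (P - c) * W s" if s: "0 < s" for s
  proof (cases "W s = \<infinity>")
    case True then show ?thesis using c by (simp add: ennreal_mult_top)
  next
    case False
    then obtain t where t: "0 \<le> t" "W s = ennreal t" by (cases "W s") auto
    have "W (2 * s) + ennreal (P - 1) * V s
      = (\<integral>\<^sup>+x. ennreal (u (2 * s) x) * w x * indicator {0<..} x + ennreal (P - 1) * (w x * indicator {0<..<s} x) \<partial>lebesgue)"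
      unfolding W_def V_def by (subst nn_integral_cmult[symmetric], measurable, rule nn_integral_add[symmetric], measurable)
    also have "\<dots> \<le> (\<integral>\<^sup>+x. ennreal (P) * (ennreal (u s x) * w x * indicator {0<..} x) \<partial>lebesgue)"
    proof (rule nn_integral_mono)
      fix x
      show "ennreal (u (2 * s) x) * w x * indicator {0<..} x + ennreal (P - 1) * (w x * indicator {0<..<s} x)
        \<le> ennreal (P) * (ennreal (u s x) * w x * indicator {0<..} x)"
      proof (cases "0 < x")
        case True
        have u0: "0 \<le> u r x" for r by (simp add: u_def)
        have "ennreal (u (2 * s) x) * w x * indicator {0<..} x + ennreal (P - 1) * (w x * indicator {0<..<s} x)
          = ennreal (u (2 * s) x + (P - 1) * indicator {0<..<s} x) * w x"
          using p2 True u0 by (auto simp: ennreal_plus distrib_right split: split_indicator)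
        also have "\<dots> \<le> ennreal (P * u s x) * w x"
          by (intro mult_right_mono ennreal_leI pw) (use s True in auto)
        finally show ?thesis using True u0 p2 by (simp add: ennreal_mult mult.assoc)
      qed auto
    qed
    also have "\<dots> = ennreal (P) * W s"
      unfolding W_def by (rule nn_integral_cmult) measurable
    finally have 1: "W (2 * s) + ennreal (P - 1) * V s \<le> ennreal (P) * W s" .
    have "ennreal c * W s \<le> ennreal c * (ennreal (1 + C) * V s)"
      by (intro mult_left_mono W_le_V s) simp
    also have "\<dots> = ennreal (P - 1) * V s"
    proof -
      have "c * (1 + C) = P - 1" using C by (simp add: c_def)
      then have "ennreal c * ennreal (1 + C) = ennreal (P - 1)"
        using c C by (subst ennreal_mult[symmetric]) auto
      then show ?thesis by (simp only: mult.assoc[symmetric])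
    qed
    finally have "W (2 * s) + ennreal c * W s \<le> ennreal (P) * W s"
      using 1 by (meson add_left_mono order_trans)
    then have 2: "W (2 * s) + ennreal (c * t) \<le> ennreal (P * t)"
      using t c by (simp add: ennreal_mult)
    then obtain t' where t': "0 \<le> t'" "W (2 * s) = ennreal t'"
      by (cases "W (2 * s)") (auto simp: top_unique)
    have "t' + c * t \<le> P * t"
      using 2 t t' c by (simp add: ennreal_plus[symmetric] del: ennreal_plus)
    then have "t' \<le> (P - c) * t" by (simp add: algebra_simps)
    then show ?thesis
      using t t' c by (simp add: ennreal_mult[symmetric] ennreal_leI)
  qed
  have iter: "W (2 ^ k * s) \<le> ennreal ((P - c) ^ k) * W s" if s: "0 < s" for k s
  proof (induction k)
    case (Suc k)
    have "W (2 ^ Suc k * s) \<le> ennreal (P - c) * W (2 ^ k * s)"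
      using step[of "2 ^ k * s"] s by (simp add: mult.assoc)
    also have "\<dots> \<le> ennreal (P - c) * (ennreal ((P - c) ^ k) * W s)"
      by (intro mult_left_mono Suc) simp
    finally show ?case using c by (simp add: ennreal_mult mult.assoc)
  qed simp
  show thesis
  proof
    show "0 < P - c" "P - c < 2 powr p" using c by (auto simp flip: P_def)
    fix k and s :: real assume s: "0 < s"
    have "V (2 ^ k * s) \<le> ennreal ((P - c) ^ k) * W s"
      using V_le_W iter[OF s] order_trans by blast
    also have "\<dots> \<le> ennreal ((P - c) ^ k) * (ennreal (1 + C) * V s)"
      by (intro mult_left_mono W_le_V s) simp
    also have "\<dots> = ennreal ((1 + C) * (P - c) ^ k) * V s"
    proof -
      have "ennreal ((1 + C) * (P - c) ^ k) = ennreal ((P - c) ^ k) * ennreal (1 + C)"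
        using c C by (subst mult.commute, intro ennreal_mult) auto
      then show ?thesis by (simp only: mult.assoc)
    qed
    finally show "(\<integral>\<^sup>+x\<in>{0<..<2 ^ k * s}. w x \<partial>lebesgue)
      \<le> ennreal ((1 + C) * (P - c) ^ k) * (\<integral>\<^sup>+x\<in>{0<..<s}. w x \<partial>lebesgue)"
      by (simp add: V_def)
  qed
qed

section \<open>Powers of series of non-negative terms\<close>

lemma ennreal_power_mono:
  assumes "a \<le> b" "0 \<le> q"
  shows "ennreal_power a q \<le> ennreal_power b q"
proof (cases b)
  case (real r)
  then obtain t where "0 \<le> t" "a = ennreal t" "t \<le> r" using assms by (cases a) (auto simp: top_unique)
  then show ?thesis using real assms by (auto simp: ennreal_power_def intro!: ennreal_leI powr_mono2)
qed (simp add: ennreal_power_def)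

text \<open>The geometric weights avoid the distinction between \<open>p \<ge> 1\<close> (Minkowski) and \<open>p < 1\<close> (subadditivity).\<close>

lemma ennreal_power_suminf_le:
  assumes a: "\<And>k. 0 \<le> a k" and \<rho>: "0 < \<rho>" "\<rho> < 1" and p: "0 < p"
  shows "ennreal_power (\<Sum>k. ennreal (a k)) p
    \<le> ennreal ((1 / (1 - \<rho>)) powr p) * (\<Sum>k. ennreal ((a k / \<rho> ^ k) powr p))"
proof (cases "\<Sum>k. ennreal ((a k / \<rho> ^ k) powr p)")
  case (real S)
  \<comment> \<open>Each term of the series on the right is at most its sum \<open>S\<close>; taking
    roots leaves a geometric majorant of \<open>a\<close>.\<close>
  have ak: "a k \<le> S powr (1 / p) * \<rho> ^ k" for k
  proof -
    define g where "g k = ennreal ((a k / \<rho> ^ k) powr p)" for k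
    have "sum g {k} \<le> suminf g" by (rule sum_le_suminf) auto
    then have "g k \<le> ennreal S" using real(2) by (simp add: g_def[abs_def])
    then have "(a k / \<rho> ^ k) powr p \<le> S" using real(1) by (simp add: g_def)
    then have "((a k / \<rho> ^ k) powr p) powr (1 / p) \<le> S powr (1 / p)"
      using p by (intro powr_mono2) auto
    then have "a k / \<rho> ^ k \<le> S powr (1 / p)"
      using p a[of k] \<rho> by (simp add: powr_powr)
    then show ?thesis using \<rho> by (simp add: field_simps)
  qed
  have "(\<lambda>k. S powr (1 / p) * \<rho> ^ k) sums (S powr (1 / p) * (1 / (1 - \<rho>)))"
    using \<rho> by (intro sums_mult geometric_sums) auto
  then have "(\<Sum>k. ennreal (S powr (1 / p) * \<rho> ^ k)) = ennreal (S powr (1 / p) * (1 / (1 - \<rho>)))"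
    using \<rho> by (intro suminf_ennreal_eq) auto
  then have "(\<Sum>k. ennreal (a k)) \<le> ennreal (S powr (1 / p) * (1 / (1 - \<rho>)))"
    using suminf_le[of "\<lambda>k. ennreal (a k)" "\<lambda>k. ennreal (S powr (1 / p) * \<rho> ^ k)"] ak
    by (auto intro: ennreal_leI)
  then have "ennreal_power (\<Sum>k. ennreal (a k)) p \<le> ennreal_power (ennreal (S powr (1 / p) * (1 / (1 - \<rho>)))) p"
    using p by (intro ennreal_power_mono) auto
  also have "\<dots> = ennreal ((1 / (1 - \<rho>)) powr p * S)"
    using \<rho> p real by (simp add: ennreal_power_def powr_mult powr_powr powr_divide)
  finally show ?thesis using real \<rho> by (simp add: ennreal_mult)
qed (use \<rho> in \<open>simp add: ennreal_mult_top\<close>)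

section \<open>Dyadic bound for the Riemann-Liouville operator\<close>

text \<open>The antiderivative \<open>- ((x - t) powr \<alpha> / \<alpha>)\<close> is continuous up
  to \<open>t = x\<close>, where the kernel is singular for \<open>\<alpha> < 1\<close>; hence the
  form of the fundamental theorem that asks for a derivative only in the interior.\<close>

lemma nn_integral_riemann_liouville_kernel:
  assumes \<alpha>: "0 < \<alpha>" and x: "0 < x"
  shows "(\<integral>\<^sup>+t\<in>{x / 2..<x}. ennreal ((x - t) powr (\<alpha> - 1)) \<partial>lebesgue) \<le> ennreal ((x / 2) powr \<alpha> / \<alpha>)"
proof -
  have "((\<lambda>t. (x - t) powr (\<alpha> - 1)) has_integral (- ((x - x) powr \<alpha> / \<alpha>) - - ((x - x / 2) powr \<alpha> / \<alpha>))) {x / 2..x}"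
  proof (rule fundamental_theorem_of_calculus_interior)
    show "continuous_on {x / 2..x} (\<lambda>t. - ((x - t) powr \<alpha> / \<alpha>))"
      using \<alpha> by (intro continuous_intros continuous_on_powr') auto
    show "((\<lambda>t. - ((x - t) powr \<alpha> / \<alpha>)) has_vector_derivative (x - t) powr (\<alpha> - 1)) (at t)" if "t \<in> {x / 2<..<x}" for t
      unfolding has_real_derivative_iff_has_vector_derivative[symmetric]
      using that \<alpha> by (auto intro!: derivative_eq_intros simp: field_simps)
  qed (use x in auto)
  from nn_integral_has_integral_lebesgue[OF _ this]
  have "(\<integral>\<^sup>+t. ennreal (indicator {x / 2..x} t * (x - t) powr (\<alpha> - 1)) \<partial>lborel) = ennreal ((x / 2) powr \<alpha> / \<alpha>)"
    by simp
  moreover have "(\<integral>\<^sup>+t\<in>{x / 2..<x}. ennreal ((x - t) powr (\<alpha> - 1)) \<partial>lebesgue)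
     \<le> (\<integral>\<^sup>+t. ennreal (indicator {x / 2..x} t * (x - t) powr (\<alpha> - 1)) \<partial>lborel)"
    unfolding nn_integral_completion by (intro nn_integral_mono) (auto split: split_indicator)
  ultimately show ?thesis by simp
qed

text \<open>Only the piece \<open>k = 0\<close> reaches the singularity at \<open>t = x\<close>. For
  \<open>k > 0\<close> the distance \<open>x - t\<close> exceeds \<open>x / 2\<close>, so the kernel
  is at most \<open>(x / 2) powr (\<alpha> - 1)\<close> and the integral at most this times the
  length of the piece. The factor \<open>2 / \<alpha>\<close> covers both cases.\<close>

lemma nn_integral_riemann_liouville_dyadic:
  assumes \<alpha>: "0 < \<alpha>" "\<alpha> < 1" and x: "0 < x"
  shows "(\<integral>\<^sup>+t\<in>{x / 2 ^ Suc k..<x / 2 ^ k}. ennreal ((x - t) powr (\<alpha> - 1)) \<partial>lebesgue)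
    \<le> ennreal (2 / \<alpha> * x powr \<alpha> / 2 ^ Suc k)"
proof (cases k)
  case 0
  have "(x / 2) powr \<alpha> / \<alpha> \<le> x powr \<alpha> / \<alpha>"
    using \<alpha> x by (intro divide_right_mono powr_mono2) auto
  then show ?thesis
    using nn_integral_riemann_liouville_kernel[OF \<alpha>(1) x] 0 by (auto intro: order_trans ennreal_leI)
next
  case (Suc m)
  have half: "x / 2 ^ k \<le> x / 2"
    using x by (simp add: Suc field_simps)
  have "(\<integral>\<^sup>+t\<in>{x / 2 ^ Suc k..<x / 2 ^ k}. ennreal ((x - t) powr (\<alpha> - 1)) \<partial>lebesgue)
    \<le> (\<integral>\<^sup>+t\<in>{x / 2 ^ Suc k..<x / 2 ^ k}. ennreal ((x / 2) powr (\<alpha> - 1)) \<partial>lebesgue)"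
  proof (rule nn_integral_mono)
    fix t
    have "(x - t) powr (\<alpha> - 1) \<le> (x / 2) powr (\<alpha> - 1)" if "t < x / 2 ^ k"
      using less_le_trans[OF that half] x \<alpha> by (intro powr_mono2') auto
    then show "ennreal ((x - t) powr (\<alpha> - 1)) * indicator {x / 2 ^ Suc k..<x / 2 ^ k} t
      \<le> ennreal ((x / 2) powr (\<alpha> - 1)) * indicator {x / 2 ^ Suc k..<x / 2 ^ k} t"
      by (auto split: split_indicator intro!: ennreal_leI)
  qed
  also have "\<dots> = ennreal ((x / 2) powr (\<alpha> - 1)) * ennreal (x / 2 ^ Suc k)"
    using x by (subst nn_integral_cmult_indicator) (auto simp: field_simps)
  also have "\<dots> = ennreal ((x / 2) powr (\<alpha> - 1) * (x / 2 ^ Suc k))"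
    by (rule ennreal_mult[symmetric]) (use x in auto)
  also have "\<dots> \<le> ennreal (2 / \<alpha> * x powr \<alpha> / 2 ^ Suc k)"
  proof (rule ennreal_leI)
    have "(x / 2) powr (\<alpha> - 1) * x = 2 * (x / 2) powr \<alpha>"
      using x by (simp add: powr_diff)
    also have "\<dots> \<le> 2 * x powr \<alpha>"
      using \<alpha> x by (intro mult_left_mono powr_mono2) auto
    also have "\<dots> \<le> 2 / \<alpha> * x powr \<alpha>"
      using \<alpha> by (intro mult_right_mono) (auto simp: field_simps)
    finally have "(x / 2) powr (\<alpha> - 1) * x / 2 ^ Suc k \<le> 2 / \<alpha> * x powr \<alpha> / 2 ^ Suc k"
      by (rule divide_right_mono) simp
    then show "(x / 2) powr (\<alpha> - 1) * (x / 2 ^ Suc k) \<le> 2 / \<alpha> * x powr \<alpha> / 2 ^ Suc k"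
      by simp
  qed
  finally show ?thesis .
qed

lemma dyadic_interval:
  fixes t x :: real
  assumes "0 < t" "t < x"
  obtains k where "x / 2 ^ Suc k \<le> t" "t < x / 2 ^ k"
proof -
  have ex: "\<exists>k. x / 2 ^ k \<le> t"
  proof -
    obtain k where "x / t < 2 ^ k" using real_arch_pow[of 2 "x / t"] by auto
    then have "x / 2 ^ k \<le> t" using assms by (simp add: field_simps)
    then show ?thesis ..
  qed
  define n where "n = (LEAST k. x / 2 ^ k \<le> t)"
  have n: "x / 2 ^ n \<le> t" unfolding n_def using ex by (rule LeastI_ex)
  \<comment> \<open>\<open>t < x\<close> rules out \<open>n = 0\<close>; minimality of
    \<open>n\<close> then gives the upper inequality.\<close>
  then obtain k where k: "n = Suc k" using assms by (cases n) auto
  have "\<not> x / 2 ^ k \<le> t"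
    using k unfolding n_def by (metis lessI not_less_Least)
  then show ?thesis using n k by (intro that[of k]) auto
qed

text \<open>On the \<open>k\<close>-th dyadic piece a decreasing \<open>f\<close> is at most its
  value at the left end \<open>x / 2 ^ Suc k\<close>. The factor \<open>x powr \<alpha>\<close> from
  the kernel integral cancels against the normalisation of the operator.\<close>

lemma riemann_liouville_le_dyadic_sum:
  assumes \<alpha>: "0 < \<alpha>" "\<alpha> < 1" and x: "0 < x" and f: "f \<in> decr_fun"
  shows "riemann_liouville \<alpha> f x \<le> (\<Sum>k. ennreal (2 / \<alpha> * f (x / 2 ^ Suc k) / 2 ^ Suc k))"
proof -
  let ?I = "\<lambda>k. {x / 2 ^ Suc k..<x / 2 ^ k}"
  let ?c = "\<lambda>k. ennreal (f (x / 2 ^ Suc k))"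
  have f0: "0 \<le> f t" if "0 < t" for t using f that by (simp add: decr_fun_def)
  have "(\<integral>\<^sup>+t\<in>{0<..<x}. ennreal (f t / (x - t) powr (1 - \<alpha>)) \<partial>lebesgue)
    \<le> (\<integral>\<^sup>+t. (\<Sum>k. ?c k * (ennreal ((x - t) powr (\<alpha> - 1)) * indicator (?I k) t)) \<partial>lebesgue)"
  proof (rule nn_integral_mono)
    fix t
    let ?h = "\<lambda>k. ?c k * (ennreal ((x - t) powr (\<alpha> - 1)) * indicator (?I k) t)"
    show "ennreal (f t / (x - t) powr (1 - \<alpha>)) * indicator {0<..<x} t \<le> (\<Sum>k. ?h k)"
    proof (cases "t \<in> {0<..<x}")
      case True
      then obtain k where k: "x / 2 ^ Suc k \<le> t" "t < x / 2 ^ k"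
        using dyadic_interval[of t x] by auto
      have "f t \<le> f (x / 2 ^ Suc k)"
        using f k(1) x True unfolding decr_fun_def monotone_on_def
        by (elim CollectE conjE) (drule bspec[of _ _ "x / 2 ^ Suc k"], auto)
      moreover have "f t / (x - t) powr (1 - \<alpha>) = f t * (x - t) powr (\<alpha> - 1)"
        using powr_minus_divide[of "x - t" "1 - \<alpha>"] by simp
      ultimately have "ennreal (f t / (x - t) powr (1 - \<alpha>)) \<le> ennreal (f (x / 2 ^ Suc k) * (x - t) powr (\<alpha> - 1))"
        by (auto intro!: ennreal_leI mult_right_mono)
      also have "\<dots> = sum ?h {k}"
        using k x f0 by (simp add: ennreal_mult)
      also have "\<dots> \<le> (\<Sum>k. ?h k)" by (rule sum_le_suminf) auto
      finally show ?thesis using True by simp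
    qed auto
  qed
  also have "\<dots> = (\<Sum>k. \<integral>\<^sup>+t. ?c k * (ennreal ((x - t) powr (\<alpha> - 1)) * indicator (?I k) t) \<partial>lebesgue)"
    by (rule nn_integral_suminf) (intro measurable_completion, simp)
  also have "\<dots> = (\<Sum>k. ?c k * (\<integral>\<^sup>+t\<in>?I k. ennreal ((x - t) powr (\<alpha> - 1)) \<partial>lebesgue))"
    by (intro suminf_cong nn_integral_cmult measurable_completion) simp
  also have "\<dots> \<le> (\<Sum>k. ?c k * ennreal (2 / \<alpha> * x powr \<alpha> / 2 ^ Suc k))"
    by (intro suminf_le mult_left_mono nn_integral_riemann_liouville_dyadic assms) auto
  finally have "riemann_liouville \<alpha> f x
    \<le> ennreal (1 / x powr \<alpha>) * (\<Sum>k. ?c k * ennreal (2 / \<alpha> * x powr \<alpha> / 2 ^ Suc k))"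
    unfolding riemann_liouville_def by (rule mult_left_mono) simp
  also have "\<dots> = (\<Sum>k. ennreal (1 / x powr \<alpha>) * (?c k * ennreal (2 / \<alpha> * x powr \<alpha> / 2 ^ Suc k)))"
    by (rule ennreal_suminf_cmult[symmetric])
  also have "\<dots> = (\<Sum>k. ennreal (2 / \<alpha> * f (x / 2 ^ Suc k) / 2 ^ Suc k))"
    using x \<alpha> f0 by (intro suminf_cong) (simp add: ennreal_mult[symmetric] field_simps)
  finally show ?thesis .
qed

section \<open>Measurable extensions, and testing (i) on step functions\<close>

lemma extend_by_zero_measurable:
  fixes f :: "real \<Rightarrow> real"
  assumes "f \<in> borel_measurable (lebesgue_on {0<..})"
  shows "(\<lambda>x. if 0 < x then f x else 0) \<in> borel_measurable lebesgue"
  using borel_measurable_if_I[OF assms] by simp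

lemma weight_supp_measurable:
  assumes "weight v"
  shows "weight_supp v \<in> sets lebesgue"
proof -
  have [measurable]: "(\<lambda>x. if 0 < x then v x else 0) \<in> borel_measurable lebesgue"
    using assms by (intro extend_by_zero_measurable) (simp add: weight_def)
  have "{x \<in> space lebesgue. (if 0 < x then v x else 0) \<noteq> 0} \<in> sets lebesgue"
    by measurable
  also have "{x \<in> space lebesgue. (if 0 < x then v x else 0) \<noteq> 0} = weight_supp v"
    by (auto simp: weight_supp_def)
  finally show ?thesis .
qed

text \<open>For \<open>0 < t < r < x\<close> the distance \<open>x - t\<close> is less than
  \<open>x\<close>, so the kernel is at least \<open>x powr (\<alpha> - 1)\<close> on an interval of
  length \<open>r\<close>.\<close>

lemma riemann_liouville_step:
  assumes \<alpha>: "0 < \<alpha>" "\<alpha> < 1" and r: "0 < r" and x: "r < x" and c: "0 \<le> c"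
  shows "ennreal (c * r / x) \<le> riemann_liouville \<alpha> (\<lambda>t. if t < r then c else 0) x"
proof -
  have "c * r / x = 1 / x powr \<alpha> * (c / x powr (1 - \<alpha>) * r)"
    using r x by (simp add: powr_diff field_simps)
  then have "ennreal (c * r / x) = ennreal (1 / x powr \<alpha>) * (ennreal (c / x powr (1 - \<alpha>)) * ennreal r)"
    using c r by (simp add: ennreal_mult[symmetric] del: times_divide_eq_left times_divide_eq_right)
  also have "\<dots> = ennreal (1 / x powr \<alpha>) * (\<integral>\<^sup>+t\<in>{0<..<r}. ennreal (c / x powr (1 - \<alpha>)) \<partial>lebesgue)"
    using r by (subst nn_integral_cmult_indicator) auto
  also have "\<dots> \<le> riemann_liouville \<alpha> (\<lambda>t. if t < r then c else 0) x"
    unfolding riemann_liouville_def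
  proof (intro mult_left_mono nn_integral_mono)
    fix t
    have "c / x powr (1 - \<alpha>) \<le> c / (x - t) powr (1 - \<alpha>)" if "0 < t" "t < r"
      using that x c \<alpha> by (intro divide_left_mono powr_mono2 mult_pos_pos) auto
    then show "ennreal (c / x powr (1 - \<alpha>)) * indicator {0<..<r} t
        \<le> ennreal ((if t < r then c else 0) / (x - t) powr (1 - \<alpha>)) * indicator {0<..<x} t"
      using x by (auto split: split_indicator intro!: ennreal_leI)
  qed simp
  finally show ?thesis .
qed

text \<open>The test function has height \<open>1 / s\<close> on \<open>(0,r)\<close>. Beyond
  \<open>r\<close> its image under the operator is at least \<open>r / (s * x)\<close>, and it
  contributes nothing to the right-hand integral there because
  \<open>0 powr p x = 0\<close>.\<close>

lemma modular_step_inequality: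
  assumes \<alpha>: "0 < \<alpha>" "\<alpha> < 1" and p: "\<forall>x>0. 0 < p x"
    and H: "\<And>f. f \<in> decr_fun \<Longrightarrow>
      (\<integral>\<^sup>+x\<in>{0<..}. ennreal_power (riemann_liouville \<alpha> f x) (p x) * ennreal (v x) \<partial>lebesgue)
        \<le> ennreal C * (\<integral>\<^sup>+x\<in>{0<..}. ennreal (f x powr p x * v x) \<partial>lebesgue)"
    and r: "0 < r" and s: "0 < s"
  shows "(\<integral>\<^sup>+x\<in>{r<..}. ennreal ((r / (s * x)) powr p x * v x) \<partial>lebesgue)
    \<le> ennreal C * (\<integral>\<^sup>+x\<in>{0<..<r}. ennreal (v x / s powr p x) \<partial>lebesgue)"
proof -
  define f where "f t = (if t < r then 1 / s else 0)" for t
  have f: "f \<in> decr_fun" using s by (auto simp: f_def decr_fun_def monotone_on_def)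
  have "(\<integral>\<^sup>+x\<in>{r<..}. ennreal ((r / (s * x)) powr p x * v x) \<partial>lebesgue)
    \<le> (\<integral>\<^sup>+x\<in>{0<..}. ennreal_power (riemann_liouville \<alpha> f x) (p x) * ennreal (v x) \<partial>lebesgue)"
  proof (rule nn_integral_mono)
    fix x
    have "ennreal ((r / (s * x)) powr p x * v x) \<le> ennreal_power (riemann_liouville \<alpha> f x) (p x) * ennreal (v x)"
      if x: "r < x"
    proof -
      have "ennreal (r / (s * x)) \<le> riemann_liouville \<alpha> f x"
        using riemann_liouville_step[OF \<alpha> r x, of "1 / s"] s by (simp add: f_def[abs_def])
      then have "ennreal_power (ennreal (r / (s * x))) (p x) \<le> ennreal_power (riemann_liouville \<alpha> f x) (p x)"
        using p r x by (intro ennreal_power_mono) (auto intro: less_imp_le)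
      moreover have "ennreal_power (ennreal (r / (s * x))) (p x) = ennreal ((r / (s * x)) powr p x)"
        using r s x by (simp add: ennreal_power_def)
      ultimately show ?thesis by (simp add: ennreal_mult' mult_right_mono)
    qed
    then show "ennreal ((r / (s * x)) powr p x * v x) * indicator {r<..} x
      \<le> ennreal_power (riemann_liouville \<alpha> f x) (p x) * ennreal (v x) * indicator {0<..} x"
      using r by (auto split: split_indicator)
  qed
  also have "\<dots> \<le> ennreal C * (\<integral>\<^sup>+x\<in>{0<..}. ennreal (f x powr p x * v x) \<partial>lebesgue)"
    by (rule H[OF f])
  also have "(\<integral>\<^sup>+x\<in>{0<..}. ennreal (f x powr p x * v x) \<partial>lebesgue)
    = (\<integral>\<^sup>+x\<in>{0<..<r}. ennreal (v x / s powr p x) \<partial>lebesgue)"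
    using s by (intro nn_integral_cong) (auto simp: f_def powr_divide split: split_indicator)
  finally show ?thesis .
qed

section \<open>From (ii) to a constant exponent and the B condition\<close>

text \<open>The sign \<sigma> treats upper and lower bounds at once. If \<open>\<sigma> * p\<close>
  exceeded \<open>a\<close> by \<epsilon> on a non-null part of the support beyond \<open>r\<close>,
  then for \<open>s\<close> a suitable power of \<tau> the left side of \<open>H\<close> would be at
  least a positive multiple of \<open>\<tau> powr (a + \<epsilon>)\<close>. The right side is at
  most a finite multiple of \<open>\<tau> powr a\<close>, by \<open>fin\<close>, so large \<tau>
  give a contradiction.\<close>

lemma exponent_bound_propagates:
  fixes v p :: "real \<Rightarrow> real"
  assumes v: "weight v" and p: "p \<in> borel_measurable (lebesgue_on {0<..})"
    and \<sigma>: "\<sigma> = 1 \<or> \<sigma> = -1" and r: "0 < r" and C: "0 \<le> C"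
    and fin: "(\<integral>\<^sup>+x\<in>{0<..<r}. ennreal (v x) \<partial>lebesgue) < \<infinity>"
    and H: "\<And>s. 0 < s \<Longrightarrow> (\<integral>\<^sup>+x\<in>{r<..}. ennreal ((r / (s * x)) powr p x * v x) \<partial>lebesgue)
      \<le> ennreal C * (\<integral>\<^sup>+x\<in>{0<..<r}. ennreal (v x / s powr p x) \<partial>lebesgue)"
    and le: "AE x in lebesgue. x \<in> weight_supp v \<longrightarrow> x < r \<longrightarrow> \<sigma> * p x \<le> a"
  shows "AE x in lebesgue. x \<in> weight_supp v \<longrightarrow> \<sigma> * p x \<le> a"
proof -
  \<comment> \<open>Values off the half-line are arbitrary; extension by zero gives functions
    measurable on the whole line.\<close>
  define q where "q x = (if 0 < x then p x else 0)" for x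
  define u where "u x = (if 0 < x then v x else 0)" for x
  have [measurable]: "q \<in> borel_measurable lebesgue" "u \<in> borel_measurable lebesgue"
    unfolding q_def[abs_def] u_def[abs_def] using p v
    by (auto intro!: extend_by_zero_measurable simp: weight_def)
  have v0: "0 \<le> v x" if "0 < x" for x using v that by (simp add: weight_def)
  obtain V where V: "0 \<le> V" "(\<integral>\<^sup>+x\<in>{0<..<r}. ennreal (v x) \<partial>lebesgue) = ennreal V"
    using fin by (cases "\<integral>\<^sup>+x\<in>{0<..<r}. ennreal (v x) \<partial>lebesgue") auto
  have "AE x in lebesgue. \<not> (r < x \<and> u x \<noteq> 0 \<and> a + \<epsilon> \<le> \<sigma> * q x)" if \<epsilon>: "0 < \<epsilon>" for \<epsilon>
  proof -
    define E where "E = {x. r < x \<and> u x \<noteq> 0 \<and> a + \<epsilon> \<le> \<sigma> * q x}"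
    have "{x \<in> space lebesgue. r < x \<and> u x \<noteq> 0 \<and> a + \<epsilon> \<le> \<sigma> * q x} \<in> sets lebesgue"
      by measurable
    then have [measurable]: "E \<in> sets lebesgue" by (simp add: E_def)
    define I where "I = (\<integral>\<^sup>+x\<in>E. ennreal ((r / x) powr q x * u x) \<partial>lebesgue)"
    have I: "ennreal (\<tau> powr (a + \<epsilon>)) * I \<le> ennreal (C * (\<tau> powr a * V))" if \<tau>: "1 < \<tau>" for \<tau>
    proof -
      \<comment> \<open>\<open>\<tau> \<longlonglongrightarrow> \<infinity>\<close> means \<open>s \<longlonglongrightarrow> 0\<close> for upper bounds (\<open>\<sigma> = 1\<close>) and \<open>s \<longlonglongrightarrow> \<infinity>\<close> for lower bounds (\<open>\<sigma> = -1\<close>).\<close>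
      define s where "s = \<tau> powr (- \<sigma>)"
      have s: "0 < s" using \<tau> by (simp add: s_def)
      have s_powr: "s powr y = \<tau> powr (- (\<sigma> * y))" for y
        by (simp add: s_def powr_powr)
      have "ennreal (\<tau> powr (a + \<epsilon>)) * I
          = (\<integral>\<^sup>+x. ennreal (\<tau> powr (a + \<epsilon>)) * (ennreal ((r / x) powr q x * u x) * indicator E x) \<partial>lebesgue)"
        unfolding I_def by (subst nn_integral_cmult) measurable
      also have "\<dots> \<le> (\<integral>\<^sup>+x\<in>{r<..}. ennreal ((r / (s * x)) powr p x * v x) \<partial>lebesgue)"
      proof (rule nn_integral_mono)
        fix x
        show "ennreal (\<tau> powr (a + \<epsilon>)) * (ennreal ((r / x) powr q x * u x) * indicator E x)
          \<le> ennreal ((r / (s * x)) powr p x * v x) * indicator {r<..} x"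
        proof (cases "x \<in> E")
          case True
          then have x: "r < x" "0 < x" "a + \<epsilon> \<le> \<sigma> * p x"
            using r by (auto simp: E_def q_def)
          have "(r / (s * x)) powr p x = (r / x) powr p x / s powr p x"
            using s r x by (simp add: powr_divide powr_mult)
          also have "\<dots> = \<tau> powr (\<sigma> * p x) * (r / x) powr p x"
            by (simp add: s_powr powr_minus_divide)
          finally have "\<tau> powr (a + \<epsilon>) * ((r / x) powr p x * v x) \<le> (r / (s * x)) powr p x * v x"
            using x v0[of x] \<tau> by (simp add: mult.assoc mult_right_mono powr_mono)
          then show ?thesis
            using True x v0[of x] by (simp add: q_def u_def ennreal_mult[symmetric] ennreal_leI)
        qed simp
      qed
      also have "\<dots> \<le> ennreal C * (\<integral>\<^sup>+x\<in>{0<..<r}. ennreal (v x / s powr p x) \<partial>lebesgue)"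
        by (rule H[OF s])
      also have "(\<integral>\<^sup>+x\<in>{0<..<r}. ennreal (v x / s powr p x) \<partial>lebesgue)
        \<le> (\<integral>\<^sup>+x. ennreal (\<tau> powr a) * (ennreal (u x) * indicator {0<..<r} x) \<partial>lebesgue)"
      proof (rule nn_integral_mono_AE)
        show "AE x in lebesgue. ennreal (v x / s powr p x) * indicator {0<..<r} x
          \<le> ennreal (\<tau> powr a) * (ennreal (u x) * indicator {0<..<r} x)"
          using le
        proof eventually_elim
          case (elim x)
          have "v x / s powr p x \<le> \<tau> powr a * v x" if "0 < x" "x < r"
          proof (cases "v x = 0")
            case False
            then have "\<sigma> * p x \<le> a" using elim that by (auto simp: weight_supp_def)
            then have "\<tau> powr (\<sigma> * p x) * v x \<le> \<tau> powr a * v x"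
              using \<tau> v0[of x] that by (intro mult_right_mono powr_mono) auto
            then show ?thesis by (simp add: s_powr powr_minus_divide mult.commute)
          qed simp
          then show ?case
            using v0[of x] by (auto simp: u_def ennreal_mult[symmetric] ennreal_leI split: split_indicator)
        qed
      qed
      also have "\<dots> = ennreal (\<tau> powr a) * (\<integral>\<^sup>+x\<in>{0<..<r}. ennreal (u x) \<partial>lebesgue)"
        by (rule nn_integral_cmult) measurable
      also have "(\<integral>\<^sup>+x\<in>{0<..<r}. ennreal (u x) \<partial>lebesgue) = ennreal V"
        unfolding V(2)[symmetric] by (intro nn_integral_cong) (auto simp: u_def split: split_indicator)
      finally show ?thesis
        using C V by (simp add: ennreal_mult mult_left_mono)
    qed
    \<comment> \<open>An infinite \<open>I\<close> contradicts the bound already for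
      \<open>\<tau> = 2\<close>.\<close>
    obtain i where i: "0 \<le> i" "I = ennreal i"
    proof (cases I)
      case top
      then show ?thesis using I[of 2] by (simp add: ennreal_mult_top top_unique)
    qed
    have "i = 0"
    proof (rule ccontr)
      assume "i \<noteq> 0"
      then have i0: "0 < i" using i by simp
      \<comment> \<open>Chosen so that \<open>\<tau> powr \<epsilon>\<close> exceeds
        \<open>C * V / i\<close>; the summand 2 also ensures \<open>\<tau> > 1\<close>.\<close>
      define \<tau> where "\<tau> = (C * V / i + 2) powr (1 / \<epsilon>)"
      have b: "1 < C * V / i + 2" 
      proof -
        have "0 \<le> C * V / i" using C V i0 by simp
        then show ?thesis by linarith
      qed
      then have \<tau>: "1 < \<tau>" using \<epsilon> by (simp add: \<tau>_def)
      have \<tau>\<epsilon>: "\<tau> powr \<epsilon> = C * V / i + 2" using b \<epsilon> by (simp add: \<tau>_def powr_powr)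
      have "\<tau> powr (a + \<epsilon>) * i \<le> C * (\<tau> powr a * V)"
        using I[OF \<tau>] i C V by (simp add: ennreal_mult[symmetric])
      then have "\<tau> powr a * (\<tau> powr \<epsilon> * i) \<le> \<tau> powr a * (C * V)"
        by (simp add: powr_add mult_ac)
      then have "\<tau> powr \<epsilon> * i \<le> C * V"
        using \<tau> by (subst (asm) mult_le_cancel_left_pos) auto
      then show False using i0 by (simp add: \<tau>\<epsilon> distrib_right)
    qed
    then have "(\<integral>\<^sup>+x. ennreal ((r / x) powr q x * u x) * indicator E x \<partial>lebesgue) = 0"
      using i by (simp add: I_def)
    then have "AE x in lebesgue. ennreal ((r / x) powr q x * u x) * indicator E x = 0"
      by (subst (asm) nn_integral_0_iff_AE) measurable
    \<comment> \<open>The integrand is strictly positive on \<open>E\<close>, so its vanishing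
      almost everywhere makes \<open>E\<close> null.\<close>
    then show ?thesis
    proof eventually_elim
      case (elim x)
      have "0 < (r / x) powr q x * u x" if "r < x" "u x \<noteq> 0"
        using that r v0[of x] by (intro mult_pos_pos) (auto simp: u_def less_le)
      then show ?case using elim by (auto simp: E_def ennreal_eq_0_iff split: split_indicator_asm)
    qed
  qed
  \<comment> \<open>The countably many values \<open>1 / real (Suc n)\<close> of \<epsilon> detect
    every positive excess over \<open>a\<close>.\<close>
  then have "AE x in lebesgue. \<forall>n. \<not> (r < x \<and> u x \<noteq> 0 \<and> a + 1 / real (Suc n) \<le> \<sigma> * q x)"
    unfolding AE_all_countable by simp
  moreover have "AE x in lebesgue. x \<noteq> r"
    by (rule AE_completion) (rule AE_lborel_singleton)
  ultimately show ?thesis using le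
  proof eventually_elim
    case (elim x)
    show ?case
    proof (intro impI)
      assume x: "x \<in> weight_supp v"
      show "\<sigma> * p x \<le> a"
      proof (rule ccontr)
        assume *: "\<not> \<sigma> * p x \<le> a"
        then have "r < x" using elim x by force
        obtain n where "1 / real (Suc n) < \<sigma> * p x - a"
          using * nat_approx_posE[of "\<sigma> * p x - a"] by auto
        then show False
          using elim(1) x \<open>r < x\<close> by (auto simp: weight_supp_def u_def q_def dest!: spec[of _ n])
      qed
    qed
  qed
qed

text \<open>Near 0 the essential supremum \<open>b\<close> of \<open>p\<close> on the support is
  finite by \<open>p_plus\<close>, and small oscillation keeps the essential infimum within
  \<epsilon> of it; \<open>a\<close> is \<open>b - \<epsilon>\<close>, which may be
  negative.\<close>

lemma local_osc_bounds:
  fixes v p :: "real \<Rightarrow> real"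
  assumes v: "weight v" and p: "p \<in> borel_measurable (lebesgue_on {0<..})" and p0: "\<forall>x>0. 0 < p x"
    and p_plus: "esssup (lebesgue_on {0<..}) (\<lambda>x. ennreal (p x)) < \<infinity>"
    and osc: "(local_osc p v \<longlongrightarrow> 0) (at_right 0)"
    and \<epsilon>: "0 < \<epsilon>" and d: "0 < d"
  obtains r a where "0 < r" "r < d"
    "AE x in lebesgue. x \<in> weight_supp v \<longrightarrow> x < r \<longrightarrow> a \<le> p x \<and> p x \<le> a + \<epsilon>"
proof -
  have "\<forall>\<^sub>F \<eta> in at_right 0. local_osc p v \<eta> < ennreal \<epsilon>"
    using order_tendstoD(2)[OF osc] \<epsilon> by simp
  moreover have "\<forall>\<^sub>F \<eta> in at_right 0. \<eta> < d" "\<forall>\<^sub>F \<eta> in at_right (0::real). 0 < \<eta>"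
    using d by (auto simp: eventually_at_right intro: exI[of _ d])
  ultimately have "\<forall>\<^sub>F \<eta> in at_right 0. local_osc p v \<eta> < ennreal \<epsilon> \<and> \<eta> < d \<and> 0 < \<eta>"
    by eventually_elim auto
  then obtain r where r: "local_osc p v r < ennreal \<epsilon>" "r < d" "0 < r"
    using eventually_happens[of _ "at_right (0::real)"] by auto
  define S where "S = {0<..<r} \<inter> weight_supp v"
  have S: "S \<in> sets lebesgue" unfolding S_def using weight_supp_measurable[OF v] by auto
  have SI: "S \<inter> space lebesgue \<in> sets lebesgue" using S by simp
  have Spos: "0 < x" if "x \<in> S" for x using that by (simp add: S_def)
  define P where "P = esssup (lebesgue_on S) (\<lambda>x. ennreal (p x))"
  define Q where "Q = essinf (lebesgue_on S) (\<lambda>x. ennreal (p x))"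
  have PQ: "P - Q < ennreal \<epsilon>" using r(1) by (simp add: local_osc_def P_def Q_def S_def)
  have "AE x in lebesgue_on {0<..}. ennreal (p x) \<le> esssup (lebesgue_on {0<..}) (\<lambda>x. ennreal (p x))"
    by (rule esssup_AE)
  then have AEB: "AE x in lebesgue_on S. ennreal (p x) \<le> esssup (lebesgue_on {0<..}) (\<lambda>x. ennreal (p x))"
    by (subst (asm) AE_restrict_space_iff, simp) (subst AE_restrict_space_iff[OF SI], auto dest: Spos elim: eventually_mono)
  have [measurable]: "p \<in> borel_measurable (lebesgue_on S)"
    by (rule measurable_restrict_mono[OF p]) (auto dest: Spos)
  have "(\<lambda>x. ennreal (p x)) \<in> borel_measurable (lebesgue_on S)"
    by measurable
  then have "P \<le> esssup (lebesgue_on {0<..}) (\<lambda>x. ennreal (p x))"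
    unfolding P_def by (intro esssup_I AEB)
  then have "P < \<infinity>" using p_plus by (rule le_less_trans)
  then obtain b where b: "0 \<le> b" "P = ennreal b" by (cases P) auto
  have up: "AE x in lebesgue_on S. p x \<le> b"
    using esssup_AE[of "\<lambda>x. ennreal (p x)" "lebesgue_on S"] b
    unfolding P_def[symmetric] by (auto elim: eventually_mono)
  have low: "AE x in lebesgue_on S. b - \<epsilon> \<le> p x"
  \<comment> \<open>For \<open>b \<le> \<epsilon>\<close> the lower bound is at most 0 and follows
    from positivity of \<open>p\<close>; this includes a null support near 0, where
    \<open>b = 0\<close>. Otherwise \<open>b - \<epsilon>\<close> is positive and
    \<open>ennreal\<close> does not truncate it.\<close>
  proof (cases "b \<le> \<epsilon>")
    case True
    have "b - \<epsilon> \<le> p x" if "x \<in> S" for x using True p0 Spos[OF that] by (smt (verit))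
    then show ?thesis by (subst AE_restrict_space_iff[OF SI]) auto
  next
    case False
    \<comment> \<open>Otherwise the oscillation \<open>P - Q\<close> would be at least
      \<open>P - ennreal (b - \<epsilon>)\<close>, which is \<epsilon>.\<close>
    have "ennreal (b - \<epsilon>) < Q"
    proof (rule ccontr)
      assume "\<not> ennreal (b - \<epsilon>) < Q"
      then have "P - ennreal (b - \<epsilon>) \<le> P - Q" by (intro ennreal_minus_mono) auto
      moreover have "P - ennreal (b - \<epsilon>) = ennreal \<epsilon>"
        using False \<epsilon> b by (subst b(2), subst ennreal_minus) auto
      ultimately show False using PQ by simp
    qed
    then obtain z where z: "ennreal (b - \<epsilon>) < z" "AE x in lebesgue_on S. z \<le> ennreal (p x)"
      unfolding Q_def essinf_def less_Sup_iff by auto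
    have AES: "AE x in lebesgue_on S. x \<in> S" by (rule AE_I2) simp
    show ?thesis using z(2) AES
    proof eventually_elim
      case (elim x)
      then have "ennreal (b - \<epsilon>) \<le> ennreal (p x)" using z(1) by (meson le_less_trans less_imp_le less_le_trans)
      then show ?case using p0 Spos[OF elim(2)] by (auto simp: ennreal_le_iff less_imp_le)
    qed
  qed
  have "AE x in lebesgue_on S. b - \<epsilon> \<le> p x \<and> p x \<le> b - \<epsilon> + \<epsilon>"
    using up low by eventually_elim simp
  then have "AE x in lebesgue. x \<in> weight_supp v \<longrightarrow> x < r \<longrightarrow> b - \<epsilon> \<le> p x \<and> p x \<le> b - \<epsilon> + \<epsilon>"
    by (subst (asm) AE_restrict_space_iff[OF SI]) (auto simp: S_def weight_supp_def elim: eventually_mono)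
  with r show thesis by (intro that[of r "b - \<epsilon>"]) auto
qed

text \<open>Near 0 the exponent lies in an interval of length \<epsilon>, and both ends of the
  interval propagate to the whole support. Only one value can lie in such intervals of every length
  \<open>1 / real (Suc n)\<close>.\<close>

lemma modular_inequality_imp_constant_exponent:
  fixes v p :: "real \<Rightarrow> real"
  assumes v: "weight v" and fin: "\<exists>\<delta>>0. (\<integral>\<^sup>+x\<in>{0<..<\<delta>}. ennreal (v x) \<partial>lebesgue) < \<infinity>"
    and p: "p \<in> borel_measurable (lebesgue_on {0<..})" and p0: "\<forall>x>0. 0 < p x"
    and p_plus: "esssup (lebesgue_on {0<..}) (\<lambda>x. ennreal (p x)) < \<infinity>"
    and osc: "(local_osc p v \<longlongrightarrow> 0) (at_right 0)"
    and C: "0 < C"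
    and H: "\<And>r s. 0 < r \<Longrightarrow> 0 < s \<Longrightarrow>
      (\<integral>\<^sup>+x\<in>{r<..}. ennreal ((r / (s * x)) powr p x * v x) \<partial>lebesgue)
        \<le> ennreal C * (\<integral>\<^sup>+x\<in>{0<..<r}. ennreal (v x / s powr p x) \<partial>lebesgue)"
  shows "\<exists>p0>0. (AE x in lebesgue_on (weight_supp v). p x = p0) \<and> v \<in> B_class p0"
proof -
  have S: "weight_supp v \<inter> space lebesgue \<in> sets lebesgue"
    using weight_supp_measurable[OF v] by simp
  obtain p0 where p0': "0 < p0" "AE x in lebesgue. x \<in> weight_supp v \<longrightarrow> p x = p0"
  proof (cases "AE x in lebesgue. x \<notin> weight_supp v")
    case True
    \<comment> \<open>If \<open>v\<close> vanishes almost everywhere, any positive constant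
      serves.\<close>
    then show ?thesis by (intro that[of 1]) (auto elim: eventually_mono)
  next
    case False
    obtain \<delta> where \<delta>: "0 < \<delta>" "(\<integral>\<^sup>+x\<in>{0<..<\<delta>}. ennreal (v x) \<partial>lebesgue) < \<infinity>" using fin by auto
    have "\<exists>a. AE x in lebesgue. x \<in> weight_supp v \<longrightarrow> a \<le> p x \<and> p x \<le> a + \<epsilon>" if \<epsilon>: "0 < \<epsilon>" for \<epsilon>
    proof -
      \<comment> \<open>Taking \<open>r\<close> below \<delta> makes the weight integrable on
        \<open>(0,r)\<close>, as propagation requires.\<close>
      obtain r a where r: "0 < r" "r < \<delta>"
        and ra: "AE x in lebesgue. x \<in> weight_supp v \<longrightarrow> x < r \<longrightarrow> a \<le> p x \<and> p x \<le> a + \<epsilon>"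
        using local_osc_bounds[OF v p p0 p_plus osc \<epsilon> \<delta>(1)] by metis
      have "(\<integral>\<^sup>+x\<in>{0<..<r}. ennreal (v x) \<partial>lebesgue) \<le> (\<integral>\<^sup>+x\<in>{0<..<\<delta>}. ennreal (v x) \<partial>lebesgue)"
        using r by (intro nn_integral_mono) (auto split: split_indicator)
      then have finr: "(\<integral>\<^sup>+x\<in>{0<..<r}. ennreal (v x) \<partial>lebesgue) < \<infinity>"
        using \<delta>(2) by (rule le_less_trans)
      have "AE x in lebesgue. x \<in> weight_supp v \<longrightarrow> 1 * p x \<le> a + \<epsilon>"
        by (rule exponent_bound_propagates[OF v p _ r(1) _ finr H[OF r(1)]])
          (use C ra in \<open>auto elim: eventually_mono\<close>)
      moreover have "AE x in lebesgue. x \<in> weight_supp v \<longrightarrow> -1 * p x \<le> - a"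
        by (rule exponent_bound_propagates[OF v p _ r(1) _ finr H[OF r(1)]])
          (use C ra in \<open>auto elim: eventually_mono\<close>)
      ultimately have "AE x in lebesgue. x \<in> weight_supp v \<longrightarrow> a \<le> p x \<and> p x \<le> a + \<epsilon>"
        by eventually_elim auto
      then show ?thesis ..
    qed
    then have "\<forall>n. \<exists>a. AE x in lebesgue. x \<in> weight_supp v \<longrightarrow> a \<le> p x \<and> p x \<le> a + 1 / real (Suc n)"
      by simp
    then obtain a where "\<And>n. AE x in lebesgue. x \<in> weight_supp v \<longrightarrow> a n \<le> p x \<and> p x \<le> a n + 1 / real (Suc n)"
      by metis
    then have a: "AE x in lebesgue. \<forall>n. x \<in> weight_supp v \<longrightarrow> a n \<le> p x \<and> p x \<le> a n + 1 / real (Suc n)"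
      unfolding AE_all_countable by simp
    \<comment> \<open>A non-null support contains a point satisfying all the bounds at once; the
      value of \<open>p\<close> there is the constant.\<close>
    have "\<exists>x0. x0 \<in> weight_supp v \<and> (\<forall>n. a n \<le> p x0 \<and> p x0 \<le> a n + 1 / real (Suc n))"
    proof (rule ccontr)
      assume none: "\<not> ?thesis"
      have "AE x in lebesgue. x \<notin> weight_supp v"
        using a by eventually_elim (use none in blast)
      then show False using False by contradiction
    qed
    then obtain x0 where x0: "x0 \<in> weight_supp v" "\<And>n. a n \<le> p x0 \<and> p x0 \<le> a n + 1 / real (Suc n)"
      by blast
    show ?thesis
    proof (rule that)
      show "0 < p x0" using p0 x0(1) by (simp add: weight_supp_def)
      show "AE x in lebesgue. x \<in> weight_supp v \<longrightarrow> p x = p x0"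
        using a
      proof eventually_elim
        case (elim x)
        show ?case
        proof (rule impI, rule ccontr)
          assume x: "x \<in> weight_supp v" and "p x \<noteq> p x0"
          then obtain n where "1 / real (Suc n) < \<bar>p x - p x0\<bar>"
            using nat_approx_posE[of "\<bar>p x - p x0\<bar>"] by auto
          moreover have "\<bar>p x - p x0\<bar> \<le> 1 / real (Suc n)"
            using elim[rule_format, OF x, of n] x0(2)[of n] by linarith
          ultimately show False by simp
        qed
      qed
    qed
  qed
  \<comment> \<open>This is (ii) with scaling parameter 1 and radius \<open>s\<close>.\<close>
  have "v \<in> B_class p0"
    unfolding B_class_def
  proof (rule CollectI, intro exI[of _ C] conjI allI impI C)
    fix s :: real assume s: "0 < s"
    have "(\<integral>\<^sup>+x\<in>{s<..}. ennreal ((s / x) powr p0 * v x) \<partial>lebesgue)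
      = (\<integral>\<^sup>+x\<in>{s<..}. ennreal ((s / (1 * x)) powr p x * v x) \<partial>lebesgue)"
      using p0'(2) s by (intro nn_integral_cong_AE)
        (auto elim!: eventually_mono simp: weight_supp_def split: split_indicator)
    also have "\<dots> \<le> ennreal C * (\<integral>\<^sup>+x\<in>{0<..<s}. ennreal (v x / 1 powr p x) \<partial>lebesgue)"
      by (rule H) (use s in auto)
    finally show "(\<integral>\<^sup>+x\<in>{s<..}. ennreal ((s / x) powr p0 * v x) \<partial>lebesgue)
      \<le> ennreal C * (\<integral>\<^sup>+x\<in>{0<..<s}. ennreal (v x) \<partial>lebesgue)" by simp
  qed
  then show ?thesis using p0' by (auto simp: AE_restrict_space_iff[OF S])
qed

section \<open>From the B condition to the modular inequality\<close>

lemma power_powr: "0 \<le> x \<Longrightarrow> (x ^ k) powr q = (x powr q) ^ k" for x q :: real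
  by (induction k) (simp_all add: powr_mult)

text \<open>The dyadic bound, the power inequality for series and the dilation estimate are
  combined; the gap between \<mu> and \<open>2 powr q\<close> has to pay both for the weights
  \<open>\<rho> ^ k\<close> in the power inequality and for convergence of the final series.\<close>

lemma B_class_imp_modular_inequality:
  fixes v p :: "real \<Rightarrow> real"
  assumes \<alpha>: "0 < \<alpha>" "\<alpha> < 1" and v: "weight v" and q: "0 < q"
    and p: "AE x in lebesgue_on (weight_supp v). p x = q" and B: "v \<in> B_class q"
  shows "\<exists>C>0::real. \<forall>f\<in>decr_fun.
    (\<integral>\<^sup>+x\<in>{0<..}. ennreal_power (riemann_liouville \<alpha> f x) (p x) * ennreal (v x) \<partial>lebesgue)
      \<le> ennreal C * (\<integral>\<^sup>+x\<in>{0<..}. ennreal (f x powr p x * v x) \<partial>lebesgue)"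
proof -
  have "weight_supp v \<inter> space lebesgue \<in> sets lebesgue"
    using weight_supp_measurable[OF v] by simp
  then have p': "AE x in lebesgue. x \<in> weight_supp v \<longrightarrow> p x = q"
    using p by (simp add: AE_restrict_space_iff)
  have v0: "0 \<le> v x" if "0 < x" for x using v that by (simp add: weight_def)
  \<comment> \<open>The estimates for dilations require a function measurable on the whole line,
    whereas \<open>v\<close> is arbitrary off the half-line.\<close>
  define w where "w x = ennreal (if 0 < x then v x else 0)" for x
  have [measurable]: "(\<lambda>x. if 0 < x then v x else 0) \<in> borel_measurable lebesgue"
    using v by (intro extend_by_zero_measurable) (simp add: weight_def)
  have w[measurable]: "w \<in> borel_measurable lebesgue" unfolding w_def[abs_def] by measurable
  obtain C where C: "0 < C" "\<And>s. 0 < s \<Longrightarrow> (\<integral>\<^sup>+x\<in>{s<..}. ennreal ((s / x) powr q * v x) \<partial>lebesgue)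
       \<le> ennreal C * (\<integral>\<^sup>+x\<in>{0<..<s}. ennreal (v x) \<partial>lebesgue)"
    using B by (auto simp: B_class_def)
  have Cw: "(\<integral>\<^sup>+x\<in>{s<..}. ennreal ((s / x) powr q) * w x \<partial>lebesgue)
    \<le> ennreal C * (\<integral>\<^sup>+x\<in>{0<..<s}. w x \<partial>lebesgue)" if s: "0 < s" for s
  proof -
    have "(\<integral>\<^sup>+x\<in>{s<..}. ennreal ((s / x) powr q) * w x \<partial>lebesgue)
      = (\<integral>\<^sup>+x\<in>{s<..}. ennreal ((s / x) powr q * v x) \<partial>lebesgue)"
      using s by (intro nn_integral_cong) (auto simp: w_def ennreal_mult' split: split_indicator)
    moreover have "(\<integral>\<^sup>+x\<in>{0<..<s}. w x \<partial>lebesgue) = (\<integral>\<^sup>+x\<in>{0<..<s}. ennreal (v x) \<partial>lebesgue)"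
      by (intro nn_integral_cong) (auto simp: w_def split: split_indicator)
    ultimately show ?thesis using C(2)[OF s] by simp
  qed
  obtain \<mu> where \<mu>: "0 < \<mu>" "\<mu> < 2 powr q"
    "\<And>k s. 0 < s \<Longrightarrow> (\<integral>\<^sup>+x\<in>{0<..<2 ^ k * s}. w x \<partial>lebesgue)
      \<le> ennreal ((1 + C) * \<mu> ^ k) * (\<integral>\<^sup>+x\<in>{0<..<s}. w x \<partial>lebesgue)"
    using B_class_self_improving[OF w q C(1) Cw] by metis
  \<comment> \<open>The ratio \<open>\<mu> / 2 powr q\<close> is split into two equal factors
    \<open>b\<close>: one is spent on the weights, through \<open>\<rho> powr q = b\<close>, and the
    other remains as the ratio of the final geometric series.\<close>
  define b where "b = sqrt (\<mu> / 2 powr q)"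
  have "\<mu> / 2 powr q < 1" using \<mu>(2) by (subst divide_less_eq_1_pos) auto
  then have b: "0 < b" "b < 1" using \<mu>(1) by (auto simp: b_def)
  have b2: "\<mu> = 2 powr q * (b * b)" using \<mu>(1) by (simp add: b_def)
  define \<rho> where "\<rho> = b powr (1 / q)"
  have \<rho>: "0 < \<rho>" "\<rho> < 1"
    using b q powr_less_mono2[of "1 / q" b 1] by (auto simp: \<rho>_def)
  have \<rho>q: "\<rho> powr q = b" using b q by (simp add: \<rho>_def powr_powr)
  define D where "D = (1 / (1 - \<rho>)) powr q"
  \<comment> \<open>The coefficient of \<open>f (x / 2 ^ Suc k) powr q\<close> in the
    \<open>k\<close>-th term of the series that \<open>ennreal_power_suminf_le\<close>
    produces.\<close>
  define e where "e k = (2 / \<alpha>) powr q / ((2 powr q) ^ Suc k * b ^ k)" for k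
  \<comment> \<open>The \<open>k\<close>-th dilation is by \<open>2 ^ Suc k\<close> and so brings in
    \<open>\<mu> ^ Suc k\<close>, while the weights enter with the power \<open>k\<close>; this
    shift leaves the factor \<open>b * b\<close>.\<close>
  define G where "G = (2 / \<alpha>) powr q * (1 + C) * (b * b)"
  have G: "0 < G" using \<alpha> C b by (simp add: G_def)
  have D: "0 < D" using \<rho> by (simp add: D_def)
  have e0: "0 \<le> e k" for k using b by (simp add: e_def)
  have eG: "e k * ((1 + C) * \<mu> ^ Suc k) = G * b ^ k" for k
    using b by (simp add: e_def b2 G_def power_mult_distrib field_simps)
  have main: "(\<integral>\<^sup>+x\<in>{0<..}. ennreal_power (riemann_liouville \<alpha> f x) (p x) * ennreal (v x) \<partial>lebesgue)
      \<le> ennreal (D * (G / (1 - b))) * (\<integral>\<^sup>+x\<in>{0<..}. ennreal (f x powr p x * v x) \<partial>lebesgue)"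
    if f: "f \<in> decr_fun" for f
  proof -
    have f0: "0 \<le> f t" if "0 < t" for t using f that by (simp add: decr_fun_def)
    define g where "g x = f x powr q" for x
    have g: "g \<in> decr_fun"
      using f q by (auto simp: g_def decr_fun_def monotone_on_def intro!: powr_mono2)
    define h where "h x = (if 0 < x then g x else 0)" for x
    have [measurable]: "h \<in> borel_measurable borel"
      unfolding h_def[abs_def] by (rule decr_fun_measurable[OF g])
    have [measurable]: "(\<lambda>x. h (x / T)) \<in> borel_measurable lebesgue" for T
      by (intro measurable_completion) simp
    define F where "F = (\<integral>\<^sup>+x\<in>{0<..}. ennreal (g x) * w x \<partial>lebesgue)"
    have "(\<integral>\<^sup>+x\<in>{0<..}. ennreal_power (riemann_liouville \<alpha> f x) (p x) * ennreal (v x) \<partial>lebesgue)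
      \<le> (\<integral>\<^sup>+x. ennreal D * (\<Sum>k. ennreal (e k) * (ennreal (h (x / 2 ^ Suc k)) * w x)) \<partial>lebesgue)"
    proof (rule nn_integral_mono_AE)
      show "AE x in lebesgue. ennreal_power (riemann_liouville \<alpha> f x) (p x) * ennreal (v x) * indicator {0<..} x
        \<le> ennreal D * (\<Sum>k. ennreal (e k) * (ennreal (h (x / 2 ^ Suc k)) * w x))"
        using p'
      proof eventually_elim
        case (elim x)
        show ?case
        \<comment> \<open>On the support \<open>p x\<close> is \<open>q\<close>; off it the left
          side vanishes.\<close>
        proof (cases "x \<in> weight_supp v")
          case True
          then have x: "0 < x" and px: "p x = q" using elim by (auto simp: weight_supp_def)
          let ?a = "\<lambda>k. 2 / \<alpha> * f (x / 2 ^ Suc k) / 2 ^ Suc k"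
          have "ennreal_power (riemann_liouville \<alpha> f x) q \<le> ennreal_power (\<Sum>k. ennreal (?a k)) q"
            using q by (intro ennreal_power_mono riemann_liouville_le_dyadic_sum \<alpha> x f) auto
          also have "\<dots> \<le> ennreal D * (\<Sum>k. ennreal ((?a k / \<rho> ^ k) powr q))"
            unfolding D_def using \<alpha> x f0 by (intro ennreal_power_suminf_le \<rho> q) auto
          also have "(\<lambda>k. ennreal ((?a k / \<rho> ^ k) powr q)) = (\<lambda>k. ennreal (e k) * ennreal (h (x / 2 ^ Suc k)))"
          proof
            fix k
            have fk: "0 \<le> f (x / 2 ^ Suc k)" using x by (intro f0) simp
            have "?a k / \<rho> ^ k = 2 / \<alpha> * f (x / 2 ^ Suc k) / (2 ^ Suc k * \<rho> ^ k)" by simp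
            also have "\<dots> powr q = (2 / \<alpha>) powr q * g (x / 2 ^ Suc k) / ((2 ^ Suc k) powr q * (\<rho> ^ k) powr q)"
              unfolding g_def by (simp only: powr_divide powr_mult)
            also have "\<dots> = e k * g (x / 2 ^ Suc k)"
              using \<rho> by (simp only: power_powr zero_le_numeral less_imp_le \<rho>q e_def) simp
            finally show "ennreal ((?a k / \<rho> ^ k) powr q) = ennreal (e k) * ennreal (h (x / 2 ^ Suc k))"
              using x e0 by (simp add: h_def ennreal_mult')
          qed
          finally have "ennreal_power (riemann_liouville \<alpha> f x) q * w x
            \<le> ennreal D * (\<Sum>k. ennreal (e k) * ennreal (h (x / 2 ^ Suc k))) * w x"
            by (rule mult_right_mono) simp
          then show ?thesis using x px by (simp add: w_def mult.assoc flip: ennreal_suminf_multc)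
        next
          case False
          then show ?thesis by (auto simp: weight_supp_def split: split_indicator)
        qed
      qed
    qed
    also have "\<dots> = ennreal D * (\<integral>\<^sup>+x. (\<Sum>k. ennreal (e k) * (ennreal (h (x / 2 ^ Suc k)) * w x)) \<partial>lebesgue)"
      by (rule nn_integral_cmult) measurable
    also have "(\<integral>\<^sup>+x. (\<Sum>k. ennreal (e k) * (ennreal (h (x / 2 ^ Suc k)) * w x)) \<partial>lebesgue)
      = (\<Sum>k. \<integral>\<^sup>+x. ennreal (e k) * (ennreal (h (x / 2 ^ Suc k)) * w x) \<partial>lebesgue)"
      by (rule nn_integral_suminf) measurable
    also have "\<dots> \<le> (\<Sum>k. ennreal (G * b ^ k) * F)"
    proof (rule suminf_le)
      fix k
      have "(\<integral>\<^sup>+x. ennreal (e k) * (ennreal (h (x / 2 ^ Suc k)) * w x) \<partial>lebesgue)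
        = ennreal (e k) * (\<integral>\<^sup>+x. ennreal (h (x / 2 ^ Suc k)) * w x \<partial>lebesgue)"
        by (rule nn_integral_cmult) measurable
      also have "(\<integral>\<^sup>+x. ennreal (h (x / 2 ^ Suc k)) * w x \<partial>lebesgue)
        = (\<integral>\<^sup>+x\<in>{0<..}. ennreal (g (x / 2 ^ Suc k)) * w x \<partial>lebesgue)"
        by (intro nn_integral_cong) (auto simp: h_def w_def zero_less_divide_iff split: split_indicator)
      also have "ennreal (e k) * \<dots> \<le> ennreal (e k) * (ennreal ((1 + C) * \<mu> ^ Suc k) * F)"
        unfolding F_def by (intro mult_left_mono nn_integral_dilate_decr_fun w \<mu>(3) g) auto
      also have "\<dots> = ennreal (e k * ((1 + C) * \<mu> ^ Suc k)) * F"
        using e0 by (simp only: ennreal_mult' mult.assoc)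
      finally show "(\<integral>\<^sup>+x. ennreal (e k) * (ennreal (h (x / 2 ^ Suc k)) * w x) \<partial>lebesgue)
        \<le> ennreal (G * b ^ k) * F" by (simp only: eG)
    qed auto
    also have "\<dots> = ennreal (G / (1 - b)) * F"
    proof -
      have "(\<lambda>k. G * b ^ k) sums (G * (1 / (1 - b)))"
        using b by (intro sums_mult geometric_sums) auto
      then have "(\<Sum>k. ennreal (G * b ^ k)) = ennreal (G * (1 / (1 - b)))"
        using b G by (intro suminf_ennreal_eq) auto
      then show ?thesis by simp
    qed
    also have "F = (\<integral>\<^sup>+x\<in>{0<..}. ennreal (f x powr p x * v x) \<partial>lebesgue)"
      unfolding F_def
    proof (rule nn_integral_cong_AE)
      show "AE x in lebesgue. ennreal (g x) * w x * indicator {0<..} x = ennreal (f x powr p x * v x) * indicator {0<..} x"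
        using p' by eventually_elim
          (auto simp: g_def w_def weight_supp_def ennreal_mult' split: split_indicator)
    qed
    also have "ennreal D * (ennreal (G / (1 - b)) * (\<integral>\<^sup>+x\<in>{0<..}. ennreal (f x powr p x * v x) \<partial>lebesgue))
      = ennreal (D * (G / (1 - b))) * (\<integral>\<^sup>+x\<in>{0<..}. ennreal (f x powr p x * v x) \<partial>lebesgue)"
    proof -
      have "ennreal (D * (G / (1 - b))) = ennreal D * ennreal (G / (1 - b))"
        by (rule ennreal_mult) (use D G b in auto)
      then show ?thesis by (simp only: mult.assoc)
    qed
    finally show ?thesis by (simp add: mult_left_mono)
  qed
  moreover have "0 < D * (G / (1 - b))" using D G b by simp
  ultimately show ?thesis by blast
qed

text \<open>Integrability of \<open>v\<close> near 0 excludes weights for which every right-hand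
  integral in (ii) is infinite: (ii) would then hold for any bounded exponent, also for one that is
  constant near 0 but not on the whole support, and (iii) would fail.\<close>

theorem theorem3p2:
  fixes \<alpha> :: real and v p :: "real \<Rightarrow> real"
  assumes alpha: "0 < \<alpha>" "\<alpha> < 1"
    and weight: "weight v"
    and integrable_near_0: "\<exists>\<delta>>0. (\<integral>\<^sup>+x\<in>{0<..<\<delta>}. ennreal (v x) \<partial>lebesgue) < \<infinity>"
    and p_measurable: "p \<in> borel_measurable (lebesgue_on {0<..})"
    and p_pos: "\<forall>x>0. 0 < p x"
    and p_minus: "0 < essinf (lebesgue_on {0<..}) (\<lambda>x. ennreal (p x))"
    and p_plus: "esssup (lebesgue_on {0<..}) (\<lambda>x. ennreal (p x)) < \<infinity>"
    and osc: "(local_osc p v \<longlongrightarrow> 0) (at_right 0)"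
  shows
    "((\<exists>C>0::real. \<forall>f\<in>decr_fun.
         (\<integral>\<^sup>+x\<in>{0<..}. ennreal_power (riemann_liouville \<alpha> f x) (p x) * ennreal (v x) \<partial>lebesgue)
           \<le> ennreal C * (\<integral>\<^sup>+x\<in>{0<..}. ennreal (f x powr p x * v x) \<partial>lebesgue))
      \<longleftrightarrow>
      (\<exists>C>0::real. \<forall>r>0. \<forall>s>0.
         (\<integral>\<^sup>+x\<in>{r<..}. ennreal ((r / (s * x)) powr p x * v x) \<partial>lebesgue)
           \<le> ennreal C * (\<integral>\<^sup>+x\<in>{0<..<r}. ennreal (v x / s powr p x) \<partial>lebesgue)))
     \<and>
     ((\<exists>C>0::real. \<forall>r>0. \<forall>s>0.
         (\<integral>\<^sup>+x\<in>{r<..}. ennreal ((r / (s * x)) powr p x * v x) \<partial>lebesgue)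
           \<le> ennreal C * (\<integral>\<^sup>+x\<in>{0<..<r}. ennreal (v x / s powr p x) \<partial>lebesgue))
      \<longleftrightarrow>
      (\<exists>p0>0. (AE x in lebesgue_on (weight_supp v). p x = p0) \<and> v \<in> B_class p0))"
(is "(?i \<longleftrightarrow> ?ii) \<and> (?ii \<longleftrightarrow> ?iii)")
proof -
  have "?i \<Longrightarrow> ?ii"
    using modular_step_inequality[OF alpha p_pos] by meson
  moreover have "?ii \<Longrightarrow> ?iii"
    using modular_inequality_imp_constant_exponent[OF weight integrable_near_0 p_measurable p_pos p_plus osc] by meson
  moreover have "?iii \<Longrightarrow> ?i"
    using B_class_imp_modular_inequality[OF alpha weight] by meson
  ultimately show ?thesis by blast
qed

end
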